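(* Let $\alpha\in(0,1/3)$ and let $D=D_n$ satisfy $D_n<n-D_n-1$. Then there is a constant $C>0$, not depending on $n$, such that $$\inf_{C_n\in\mathcal C_n}\ \sup_{P\in\mathcal P}\ \mathbb E(W_n^2)\ \ge\ \frac{C}{n-D+1},$$ where $\mathcal P$ is the class of linear regression distributions, $\mathcal C_n$ is the set of all $1-\alpha$ confidence intervals for the first regression coefficient $\beta_1$ based on $n$ i.i.d. observations, and $W_n$ is the width of $C_n$ (all defined in the context).
   Context: Fix $0<a\le A<\infty$ and $\sigma^2>0$. Let $\mathcal S(a,A)$ be the set of symmetric $D\times D$ matrices $\Sigma$ with $a\le\lambda_{\min}(\Sigma)\le\lambda_{\max}(\Sigma)\le A$. The class $\mathcal P$ consists of all distributions $P$ of $(X,Y)$, $X=(X_1,\dots,X_D)$, with $Y=\beta_1X_1+\cdots+\beta_DX_D+\epsilon$, where $\beta\in\mathbb R^D$, $\epsilon\sim N(0,\sigma^2)$ is the noise (independent of $X$), and $\mathrm{Cov}(X)\in\mathcal S(a,A)$. The data are $n$ i.i.d. draws from $P$, with joint law $P^n$. A set-valued function $C_n$ of the data is a $1-\alpha$ confidence interval for $\beta_1$ if $P^n(\beta_1\in C_n)\ge 1-\alpha$ for all $P\in\mathcal P$; $\mathcal C_n$ is the set of all such $C_n$. The width is $W_n=\sup\{x: x\in C_n\}-\inf\{x:x\in C_n\}$, and $\mathbb E$ is expectation under $P^n$. The dimension $D=D_n$ may depend on $n$. *)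

theory Defs
  imports "HOL-Probability.Probability" "Jordan_Normal_Form.Spectral_Radius"
begin

text \<open>
  The dimension \<open>D\<close> varies with the sample size, so vectors in $R^D$ are functions on the
  index set \<open>{..<D}\<close>. Coordinates are counted from \<open>0\<close>: the first
  covariate is \<open>fst z 0\<close> and the first regression coefficient is \<open>\<beta> 0\<close>.
  One observation is a pair \<open>(x, y)\<close>.
\<close>

type_synonym obs = "(nat \<Rightarrow> real) \<times> real"

definition obs_space :: "nat \<Rightarrow> obs measure" where
  "obs_space D = (\<Pi>\<^sub>M i\<in>{..<D}. borel) \<Otimes>\<^sub>M borel"

definition covariance :: "'a measure \<Rightarrow> ('a \<Rightarrow> real) \<Rightarrow> ('a \<Rightarrow> real) \<Rightarrow> real" where
  "covariance M U V =
     integral\<^sup>L M (\<lambda>z. (U z - integral\<^sup>L M U) * (V z - integral\<^sup>L M V))"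

definition cov_mat :: "nat \<Rightarrow> obs measure \<Rightarrow> real mat" where
  "cov_mat D P = mat D D (\<lambda>(i, j). covariance P (\<lambda>z. fst z i) (\<lambda>z. fst z j))"

text \<open>
  Since \<open>S\<close> is symmetric, its real spectrum is its full set of eigenvalues; it is finite, and
  nonempty for \<open>D \<ge> 1\<close>.
\<close>

definition sym_mats :: "nat \<Rightarrow> real \<Rightarrow> real \<Rightarrow> real mat set" where
  "sym_mats D a A = {S \<in> carrier_mat D D. transpose_mat S = S \<and>
     a \<le> Min (spectrum S) \<and> Max (spectrum S) \<le> A}"

definition noise :: "nat \<Rightarrow> (nat \<Rightarrow> real) \<Rightarrow> obs \<Rightarrow> real" where
  "noise D \<beta> = (\<lambda>(x, y). y - (\<Sum>i<D. \<beta> i * x i))"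

text \<open>
  \<open>P\<close> is a joint law of \<open>(X, Y)\<close> satisfying the linear model with coefficients \<open>\<beta>\<close>. Square
  integrability is what makes \<open>Cov(X)\<close> exist. No further condition, such as centering, is put
  on \<open>X\<close>. Independence of \<open>X\<close> and the noise is stated through the sigma-algebras they
  generate, since \<open>prob_space.indep_var\<close> needs both variables to have the same type.
\<close>

definition linear_model ::
    "nat \<Rightarrow> real \<Rightarrow> real \<Rightarrow> real \<Rightarrow> (nat \<Rightarrow> real) \<Rightarrow> obs measure \<Rightarrow> bool" where
  "linear_model D a A \<sigma> \<beta> P \<longleftrightarrow>
     prob_space P \<and> sets P = sets (obs_space D) \<and>
     (\<forall>i<D. integrable P (\<lambda>z. (fst z i)\<^sup>2)) \<and>
     cov_mat D P \<in> sym_mats D a A \<and>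
     distributed P lborel (noise D \<beta>) (normal_density 0 \<sigma>) \<and>
     prob_space.indep_set P
       {fst -` B \<inter> space P | B. B \<in> sets (\<Pi>\<^sub>M i\<in>{..<D}. borel)}
       {noise D \<beta> -` B \<inter> space P | B. B \<in> sets borel}"

definition model_class :: "nat \<Rightarrow> real \<Rightarrow> real \<Rightarrow> real \<Rightarrow> obs measure set" where
  "model_class D a A \<sigma> = {P. \<exists>\<beta>. linear_model D a A \<sigma> \<beta> P}"

definition iid_law :: "nat \<Rightarrow> obs measure \<Rightarrow> (nat \<Rightarrow> obs) measure" where
  "iid_law n P = (\<Pi>\<^sub>M k\<in>{..<n}. P)"

text \<open>
  Quantifying over all \<open>P\<close> and \<open>\<beta>\<close> with \<open>linear_model D a A \<sigma> \<beta> P\<close> is quantifying over all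
  \<open>P\<close> in the class: \<open>\<beta>\<close> is determined by \<open>P\<close> on \<open>{..<D}\<close> when \<open>0 < a\<close>. The coverage
  event has to be measurable for its probability to make sense; nothing else is required of
  \<open>C\<close>.
\<close>

definition conf_intervals ::
    "nat \<Rightarrow> nat \<Rightarrow> real \<Rightarrow> real \<Rightarrow> real \<Rightarrow> real \<Rightarrow> ((nat \<Rightarrow> obs) \<Rightarrow> real set) set" where
  "conf_intervals n D a A \<sigma> \<alpha> = {C. \<forall>P \<beta>. linear_model D a A \<sigma> \<beta> P \<longrightarrow>
     {w \<in> space (iid_law n P). \<beta> 0 \<in> C w} \<in> sets (iid_law n P) \<and>
     measure (iid_law n P) {w \<in> space (iid_law n P). \<beta> 0 \<in> C w} \<ge> 1 - \<alpha>}"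

text \<open>
  Unbounded sets have width \<open>\<infinity>\<close>. For the empty set the difference is \<open>-\<infinity>\<close>, which
  \<open>e2ennreal\<close> truncates to \<open>0\<close>; on nonempty sets the truncation has no effect.
\<close>

definition width :: "real set \<Rightarrow> ennreal" where
  "width S = e2ennreal ((SUP x\<in>S. ereal x) - (INF x\<in>S. ereal x))"

text \<open>
  If \<open>width (C w)\<close> is not measurable in \<open>w\<close>, the integral is the lower integral, which can only
  make a lower bound harder.
\<close>

definition expected_sq_width ::
    "nat \<Rightarrow> obs measure \<Rightarrow> ((nat \<Rightarrow> obs) \<Rightarrow> real set) \<Rightarrow> ennreal" where
  "expected_sq_width n P C = (\<integral>\<^sup>+ w. (width (C w))\<^sup>2 \<partial>iid_law n P)"

end

theory Submission
  imports Defs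
begin

text \<open>
  Le Cam's two-point method. Let the covariates be independent signs \<open>\<plusminus>sqrt a\<close>, so that
  \<open>Cov(X) = a I\<close>, and compare \<open>\<beta> = 0\<close> with \<open>\<beta> = (\<delta>, 0, \<dots>, 0)\<close>. The likelihood ratio of
  the two models has second moment \<open>exp (\<delta>^2 a / \<sigma>^2)\<close> under the first one; with
  \<open>\<delta>^2\<close> a constant multiple of \<open>1 / n\<close> the second moment for \<open>n\<close> observations is \<open>37 / 36\<close>, and
  the two laws of the data differ by at most \<open>1 / 6\<close> on every event. Both \<open>0\<close> and \<open>\<delta>\<close>
  thus lie in a confidence set with probability at least \<open>1 - 2 \<alpha> - 1 / 6 \<ge> 1 / 6\<close>, and then its
  width is at least \<open>\<delta>\<close>. Since \<open>2 D + 1 < n\<close>, the rates \<open>1 / n\<close> and \<open>1 / (n - D + 1)\<close> agree up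
  to a constant.
\<close>

section \<open>Change of measure\<close>

text \<open>Since \<open>L\<close> has mean 1, \<open>K - 1\<close> is the chi-square divergence of
  \<open>density M L\<close> from \<open>M\<close>. The weight \<open>t\<close> is left free; for
  \<open>K > 1\<close> the best choice \<open>t = sqrt (K - 1)\<close> turns the two error terms
  into \<open>sqrt (K - 1)\<close>.\<close>

lemma measure_density_le_plus_chi_square:
  fixes L :: "'a \<Rightarrow> real"
  assumes "prob_space M" and "prob_space (density M L)"
    and L [measurable]: "L \<in> borel_measurable M" and L0: "\<And>x. 0 \<le> L x"
    and K: "(\<integral>\<^sup>+ x. (L x)\<^sup>2 \<partial>M) = ennreal K" "0 \<le> K"
    and S [measurable]: "S \<in> sets M" and t: "0 < t"
  shows "measure (density M L) S \<le> measure M S + t / 2 + (K - 1) / (2 * t)"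
proof -
  interpret M: prob_space M by fact
  interpret N: prob_space "density M L" by fact
  have "(\<integral>\<^sup>+ x. L x \<partial>M) = emeasure (density M L) (space M)"
    by (subst emeasure_density) (auto intro!: nn_integral_cong)
  also have "\<dots> = ennreal 1"
    using N.emeasure_space_1 by simp
  finally have L1: "has_bochner_integral M L 1"
    using L0 by (intro has_bochner_integral_nn_integral) auto
  have L2: "has_bochner_integral M (\<lambda>x. (L x)\<^sup>2) K"
    using K by (intro has_bochner_integral_nn_integral) auto
  have iL: "integrable M L" "integrable M (\<lambda>x. (L x)\<^sup>2)"
    and L_eq: "integral\<^sup>L M L = 1" "(\<integral> x. (L x)\<^sup>2 \<partial>M) = K"
    using L1 L2 unfolding has_bochner_integral_iff by blast+
  have i: "integrable M (\<lambda>x. (L x)\<^sup>2 - 2 * L x + 1)"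
    using iL by auto
  have "(\<integral> x. (L x)\<^sup>2 - 2 * L x + 1 \<partial>M) = K - 1"
    using iL by (simp add: L_eq M.prob_space)
  then have "has_bochner_integral M (\<lambda>x. (L x)\<^sup>2 - 2 * L x + 1) (K - 1)"
    using i by (simp add: has_bochner_integral_iff)
  then have "has_bochner_integral M (\<lambda>x. ((L x)\<^sup>2 - 2 * L x + 1) / (2 * t)) ((K - 1) / (2 * t))"
    using t by (intro has_bochner_integral_divide) auto
  moreover have "has_bochner_integral M (\<lambda>x. t / 2) (t / 2)"
    by (simp add: has_bochner_integral_iff M.prob_space)
  moreover have "has_bochner_integral M (indicator S) (measure M S)"
    by (intro has_bochner_integral_real_indicator) (auto simp: less_top[symmetric])
  ultimately have bound: "has_bochner_integral M
      (\<lambda>x. indicator S x + (t / 2 + ((L x)\<^sup>2 - 2 * L x + 1) / (2 * t)))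
      (measure M S + (t / 2 + (K - 1) / (2 * t)))"
    by (intro has_bochner_integral_add)
  have iS: "integrable M (\<lambda>x. L x * indicator S x)"
    using integrable_mult_indicator[OF S iL(1)] by (simp add: mult.commute)
  have "emeasure (density M L) S = (\<integral>\<^sup>+ x. ennreal (L x * indicator S x) \<partial>M)"
    using L0 by (subst emeasure_density) (auto intro!: nn_integral_cong split: split_indicator)
  also have "\<dots> = ennreal (\<integral> x. L x * indicator S x \<partial>M)"
    using iS L0 by (intro nn_integral_eq_integral) auto
  finally have "measure (density M L) S = (\<integral> x. L x * indicator S x \<partial>M)"
    using L0 by (simp add: measure_def)
  \<comment> \<open>AM-GM: \<open>L - 1 \<le> t / 2 + (L - 1)^2 / (2 t)\<close>, which spares the Cauchy-Schwarz inequality.\<close>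
  also have "\<dots> \<le> (\<integral> x. indicator S x + (t / 2 + ((L x)\<^sup>2 - 2 * L x + 1) / (2 * t)) \<partial>M)"
  proof (rule integral_mono)
    fix x
    \<comment> \<open>The first square gives the bound on \<open>S\<close>; the second makes the
      right-hand side nonnegative off \<open>S\<close>.\<close>
    have "0 \<le> (L x - 1 - t)\<^sup>2 / (2 * t)" "0 \<le> (L x - 1)\<^sup>2 / (2 * t)"
      using t by auto
    moreover have "(L x - 1 - t)\<^sup>2 / (2 * t) = t / 2 + ((L x)\<^sup>2 - 2 * L x + 1) / (2 * t) - (L x - 1)"
      using t by (simp add: field_simps power2_eq_square)
    moreover have "(L x - 1)\<^sup>2 = (L x)\<^sup>2 - 2 * L x + 1"
      by (simp add: power2_eq_square algebra_simps)
    ultimately show "L x * indicator S x \<le>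
        indicator S x + (t / 2 + ((L x)\<^sup>2 - 2 * L x + 1) / (2 * t))"
      using t by (auto split: split_indicator)
  qed (use iS bound in \<open>auto simp: has_bochner_integral_iff\<close>)
  also have "\<dots> = measure M S + t / 2 + (K - 1) / (2 * t)"
    using bound by (simp add: has_bochner_integral_iff)
  finally show ?thesis .
qed

text \<open>A finite product measure is determined by its values on boxes, and on a box the integral
  of the product splits by Fubini. This makes the likelihood ratio of a sample the product of the
  ratios of its observations.\<close>

lemma PiM_density:
  assumes "\<And>i. sigma_finite_measure (M i)" and "\<And>i. sigma_finite_measure (density (M i) (f i))"
    and "finite I" and f [measurable]: "\<And>i. f i \<in> borel_measurable (M i)"
  shows "PiM I (\<lambda>i. density (M i) (f i)) = density (PiM I M) (\<lambda>w. \<Prod>i\<in>I. f i (w i))"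
proof -
  interpret M: product_sigma_finite M
    using assms(1) by (rule product_sigma_finite.intro)
  interpret N: product_sigma_finite "\<lambda>i. density (M i) (f i)"
    using assms(2) by (rule product_sigma_finite.intro)
  note [measurable] = measurable_component_singleton
  have "density (PiM I M) (\<lambda>w. \<Prod>i\<in>I. f i (w i)) = PiM I (\<lambda>i. density (M i) (f i))"
  proof (rule N.PiM_eqI)
    fix B assume B [measurable]: "\<And>i. i \<in> I \<Longrightarrow> B i \<in> sets (density (M i) (f i))"
    have "emeasure (density (PiM I M) (\<lambda>w. \<Prod>i\<in>I. f i (w i))) (Pi\<^sub>E I B) =
        (\<integral>\<^sup>+ w. (\<Prod>i\<in>I. f i (w i)) * indicator (Pi\<^sub>E I B) w \<partial>PiM I M)"
      using B \<open>finite I\<close> by (subst emeasure_density) (auto intro!: sets_PiM_I_finite)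
    also have "\<dots> = (\<integral>\<^sup>+ w. (\<Prod>i\<in>I. f i (w i) * indicator (B i) (w i)) \<partial>PiM I M)"
    proof (intro nn_integral_cong)
      fix w assume w: "w \<in> space (PiM I M)"
      show "(\<Prod>i\<in>I. f i (w i)) * indicator (Pi\<^sub>E I B) w =
          (\<Prod>i\<in>I. f i (w i) * indicator (B i) (w i))"
      proof (cases "w \<in> Pi\<^sub>E I B")
        case True
        then show ?thesis by (auto intro!: prod.cong simp: PiE_iff)
      next
        case False
        \<comment> \<open>As \<open>w\<close> lies in the product space, it is already extensional
          outside \<open>I\<close>; leaving the box therefore happens in a coordinate of
          \<open>I\<close>.\<close>
        then obtain i where "i \<in> I" "w i \<notin> B i"
          using w by (auto simp: space_PiM PiE_iff)
        then have "(\<Prod>i\<in>I. f i (w i) * indicator (B i) (w i)) = 0"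
          using \<open>finite I\<close> by (intro prod_zero) (auto intro!: bexI[of _ i])
        with False show ?thesis by simp
      qed
    qed
    also have "\<dots> = (\<Prod>i\<in>I. \<integral>\<^sup>+ x. f i x * indicator (B i) x \<partial>M i)"
      using B \<open>finite I\<close> by (intro M.product_nn_integral_prod) auto
    also have "\<dots> = (\<Prod>i\<in>I. emeasure (density (M i) (f i)) (B i))"
      using B by (intro prod.cong refl) (simp add: emeasure_density)
    finally show "emeasure (density (PiM I M) (\<lambda>w. \<Prod>i\<in>I. f i (w i))) (Pi\<^sub>E I B) =
        (\<Prod>i\<in>I. emeasure (density (M i) (f i)) (B i))" .
  qed (use \<open>finite I\<close> in \<open>auto cong: sets_PiM_cong\<close>)
  then show ?thesis ..
qed

section \<open>Covariates with independent signs\<close>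

text \<open>The uniform law on \<open>{- s, s}\<close>, pushed from the discrete sigma-algebra of a
  pmf to the Borel one that \<open>obs_space\<close> uses.\<close>

definition sign_measure :: "real \<Rightarrow> real measure" where
  "sign_measure s = distr (measure_pmf (pmf_of_set {- s, s})) borel id"

lemma sets_sign_measure [simp, measurable_cong]: "sets (sign_measure s) = sets borel"
  by (simp add: sign_measure_def)

lemma prob_space_sign_measure: "prob_space (sign_measure s)"
  unfolding sign_measure_def by (intro measure_pmf.prob_space_distr) auto

lemma integrable_sign_measure:
  fixes f :: "real \<Rightarrow> real"
  assumes "f \<in> borel_measurable borel"
  shows "integrable (sign_measure s) f"
  unfolding sign_measure_def using assms
  by (subst integrable_distr_eq) (auto intro!: integrable_measure_pmf_finite)

lemma integral_sign_measure:
  fixes f :: "real \<Rightarrow> real"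
  assumes "f \<in> borel_measurable borel" and "s > 0"
  shows "integral\<^sup>L (sign_measure s) f = (f s + f (- s)) / 2"
  unfolding sign_measure_def using assms
  by (subst integral_distr) (auto simp: integral_pmf_of_set)

lemma AE_sign_measure: "AE x in sign_measure s. x\<^sup>2 = s\<^sup>2"
  unfolding sign_measure_def
  by (subst AE_distr_iff) (auto simp: AE_measure_pmf_iff)

definition sign_covariates :: "nat \<Rightarrow> real \<Rightarrow> (nat \<Rightarrow> real) measure" where
  "sign_covariates D s = (\<Pi>\<^sub>M i\<in>{..<D}. sign_measure s)"

lemma sets_sign_covariates [simp, measurable_cong]:
  "sets (sign_covariates D s) = sets (\<Pi>\<^sub>M i\<in>{..<D}. borel)"
  unfolding sign_covariates_def by (intro sets_PiM_cong) auto

lemma prob_space_sign_covariates: "prob_space (sign_covariates D s)"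
  unfolding sign_covariates_def by (intro prob_space_PiM prob_space_sign_measure)

lemma AE_sign_covariates:
  assumes "i < D"
  shows "AE x in sign_covariates D s. (x i)\<^sup>2 = s\<^sup>2"
  unfolding sign_covariates_def
  using assms by (intro AE_PiM_component prob_space_sign_measure AE_sign_measure) auto

text \<open>The coordinates are independent: each monomial is rewritten as a product over
  \<open>k\<close> of functions of \<open>x k\<close> alone, so its integral factors. A coordinate
  occurring to the first power contributes the mean of a sign, which is 0.\<close>

lemma sign_covariates_moments:
  assumes "0 < s" and ij: "i < D" "j < D"
  shows "integrable (sign_covariates D s) (\<lambda>x. x i * x j)" (is ?int)
    and "(\<integral> x. x i * x j \<partial>sign_covariates D s) = (if i = j then s\<^sup>2 else 0)" (is ?second)
    and "(\<integral> x. x i \<partial>sign_covariates D s) = 0" (is ?first)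
proof -
  interpret S: prob_space "sign_measure s" by (rule prob_space_sign_measure)
  interpret product_sigma_finite "\<lambda>_::nat. sign_measure s" ..
  \<comment> \<open>\<open>?f k\<close> gathers the factors of \<open>x i * x j\<close> that live on
    coordinate \<open>k\<close>; for \<open>i = j\<close> both land on the same coordinate and give
    a square.\<close>
  let ?f = "\<lambda>k y. (if k = i then y else 1) * (if k = j then y else (1::real))"
  have eq: "(\<lambda>x. x i * x j) = (\<lambda>x. \<Prod>k<D. ?f k (x k))"
    using ij by (simp add: prod.distrib fun_eq_iff)
  have eq1: "(\<lambda>x. x i) = (\<lambda>x. \<Prod>k<D. if k = i then x k else (1::real))"
    using ij by (simp add: fun_eq_iff)
  show ?int
    unfolding eq sign_covariates_def
    by (intro product_integrable_prod integrable_sign_measure) auto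
  have "(\<integral> x. x i * x j \<partial>sign_covariates D s) = (\<Prod>k<D. integral\<^sup>L (sign_measure s) (?f k))"
    unfolding eq sign_covariates_def
    by (intro product_integral_prod integrable_sign_measure) auto
  also have "\<dots> = (\<Prod>k<D. (?f k s + ?f k (- s)) / 2)"
    using \<open>0 < s\<close> by (intro prod.cong refl integral_sign_measure) auto
  also have "\<dots> = (if i = j then s\<^sup>2 else 0)"
  proof (cases "i = j")
    case True
    then have "(\<lambda>k. (?f k s + ?f k (- s)) / 2) = (\<lambda>k. if k = j then s\<^sup>2 else 1)"
      by (auto simp: fun_eq_iff power2_eq_square)
    then have "(\<Prod>k<D. (?f k s + ?f k (- s)) / 2) = (\<Prod>k<D. if k = j then s\<^sup>2 else 1)"
      by (simp add: fun_eq_iff)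
    with True ij show ?thesis by simp
  next
    case False
    then have "(\<Prod>k<D. (?f k s + ?f k (- s)) / 2) = 0"
      using ij by (intro prod_zero) (auto intro!: bexI[of _ i])
    with False show ?thesis by simp
  qed
  finally show ?second .
  have "(\<integral> x. x i \<partial>sign_covariates D s) =
      (\<Prod>k<D. integral\<^sup>L (sign_measure s) (\<lambda>y. if k = i then y else 1))"
    unfolding eq1 sign_covariates_def
    by (intro product_integral_prod integrable_sign_measure) auto
  also have "\<dots> = 0"
    using ij \<open>0 < s\<close> by (intro prod_zero) (auto intro!: bexI[of _ i] simp: integral_sign_measure)
  finally show ?first .
qed

text \<open>The matrix multiplies every vector by \<open>c\<close>, which rules out any other
  eigenvalue, and \<open>0 < n\<close> supplies an eigenvector. As \<open>sym_mats\<close> is stated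
  through the spectrum, this is how the covariance \<open>a I\<close> is placed in it.\<close>

lemma spectrum_smult_one:
  fixes c :: "'a :: field"
  assumes "0 < n"
  shows "spectrum (c \<cdot>\<^sub>m 1\<^sub>m n) = {c}"
proof -
  have eq: "(c \<cdot>\<^sub>m 1\<^sub>m n) *\<^sub>v v = c \<cdot>\<^sub>v v" if "v \<in> carrier_vec n" for v
    using that by (intro eq_vecI) (auto simp: scalar_prod_def if_distrib if_distribR cong: if_cong)
  have "c \<in> spectrum (c \<cdot>\<^sub>m 1\<^sub>m n)"
  proof -
    have "(unit_vec n 0 :: 'a vec) \<noteq> 0\<^sub>v n"
      using assms by (metis index_unit_vec(2) index_zero_vec(1) zero_neq_one)
    then have "eigenvector (c \<cdot>\<^sub>m 1\<^sub>m n) (unit_vec n 0) c"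
      by (simp add: eigenvector_def eq)
    then show ?thesis by (auto simp: spectrum_def eigenvalue_def)
  qed
  moreover have "k = c" if k: "k \<in> spectrum (c \<cdot>\<^sub>m 1\<^sub>m n)" for k
  proof -
    obtain v where v: "v \<in> carrier_vec n" "v \<noteq> 0\<^sub>v n" "c \<cdot>\<^sub>v v = k \<cdot>\<^sub>v v"
      using k by (auto simp: spectrum_def eigenvalue_def eigenvector_def eq)
    then obtain i where "i < n" "v $ i \<noteq> 0"
      by (metis carrier_vecD eq_vecI index_zero_vec)
    moreover have "c * v $ i = k * v $ i"
      using v \<open>i < n\<close> by (metis carrier_vecD index_smult_vec(1))
    ultimately show ?thesis by simp
  qed
  ultimately show ?thesis by auto
qed

section \<open>Gaussian regression with given covariates\<close>

definition gauss :: "real \<Rightarrow> real measure" where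
  "gauss \<sigma> = density lborel (normal_density 0 \<sigma>)"

lemma sets_gauss [simp, measurable_cong]: "sets (gauss \<sigma>) = sets borel"
  by (simp add: gauss_def)

lemma prob_space_gauss: "0 < \<sigma> \<Longrightarrow> prob_space (gauss \<sigma>)"
  unfolding gauss_def by (rule prob_space_normal_density)

text \<open>The image of a product measure, so that covariates and noise are independent by
  construction. The coefficients enter only through the map.\<close>

definition model_law ::
    "nat \<Rightarrow> (nat \<Rightarrow> real) measure \<Rightarrow> real \<Rightarrow> (nat \<Rightarrow> real) \<Rightarrow> obs measure" where
  "model_law D X \<sigma> \<beta> = distr (X \<Otimes>\<^sub>M gauss \<sigma>) (obs_space D)
     (\<lambda>(x, e). (x, (\<Sum>i<D. \<beta> i * x i) + e))"

context
  fixes D :: nat and X :: "(nat \<Rightarrow> real) measure" and \<sigma> :: real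
  assumes X: "prob_space X" and sets_X [simp, measurable_cong]: "sets X = sets (\<Pi>\<^sub>M i\<in>{..<D}. borel)"
    and \<sigma>: "0 < \<sigma>"
begin

interpretation X: prob_space X by (rule X)
interpretation N: prob_space "gauss \<sigma>" using \<sigma> by (rule prob_space_gauss)
interpretation XN: pair_prob_space X "gauss \<sigma>" ..

lemma measurable_linear_form [measurable]:
  "(\<lambda>x. \<Sum>i<D. \<beta> i * x i) \<in> borel_measurable (\<Pi>\<^sub>M i\<in>{..<D}. borel)" for \<beta> :: "nat \<Rightarrow> real"
  by measurable

lemma measurable_model_map [measurable]:
  "(\<lambda>(x, e). (x, (\<Sum>i<D. \<beta> i * x i) + e)) \<in> measurable (X \<Otimes>\<^sub>M gauss \<sigma>) (obs_space D)"
proof -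
  have [measurable]: "(\<lambda>x. \<Sum>i<D. \<beta> i * x i) \<in> borel_measurable X"
    using measurable_linear_form by (simp cong: measurable_cong_sets)
  show ?thesis unfolding obs_space_def by measurable
qed

lemma sets_model_law [simp, measurable_cong]: "sets (model_law D X \<sigma> \<beta>) = sets (obs_space D)"
  by (simp add: model_law_def)

lemma space_model_law: "space (model_law D X \<sigma> \<beta>) = space (obs_space D)"
  by (simp add: model_law_def)

lemma prob_space_model_law: "prob_space (model_law D X \<sigma> \<beta>)"
  unfolding model_law_def by (rule XN.prob_space_distr) measurable

text \<open>Given \<open>x\<close>, the response is normal around the linear form: Fubini, followed
  by the translation \<open>y = m + e\<close>. With \<beta> moved from the map into the density,
  laws with different coefficients can be compared pointwise.\<close>

lemma nn_integral_model_law: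
  assumes f [measurable]: "f \<in> borel_measurable (obs_space D)"
  shows "(\<integral>\<^sup>+ z. f z \<partial>model_law D X \<sigma> \<beta>) =
    (\<integral>\<^sup>+ x. \<integral>\<^sup>+ y. f (x, y) * ennreal (normal_density (\<Sum>i<D. \<beta> i * x i) \<sigma> y) \<partial>lborel \<partial>X)"
proof -
  let ?m = "\<lambda>x. \<Sum>i<D. \<beta> i * x i"
  have [measurable]: "f \<in> borel_measurable ((\<Pi>\<^sub>M i\<in>{..<D}. borel) \<Otimes>\<^sub>M borel)"
    using f by (simp add: obs_space_def)
  have fc: "(\<lambda>y. f (x, y)) \<in> borel_measurable borel" if "x \<in> space X" for x
  proof -
    have "x \<in> space (\<Pi>\<^sub>M i\<in>{..<D}. borel)"
      using that sets_eq_imp_space_eq[OF sets_X] by simp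
    then show ?thesis by measurable
  qed
  have "(\<integral>\<^sup>+ z. f z \<partial>model_law D X \<sigma> \<beta>) =
      (\<integral>\<^sup>+ z. f (case z of (x, e) \<Rightarrow> (x, ?m x + e)) \<partial>(X \<Otimes>\<^sub>M gauss \<sigma>))"
    unfolding model_law_def by (rule nn_integral_distr) measurable
  also have "\<dots> = (\<integral>\<^sup>+ x. \<integral>\<^sup>+ e. f (x, ?m x + e) \<partial>gauss \<sigma> \<partial>X)"
    by (subst N.nn_integral_fst[symmetric]) (auto intro: measurable_compose[OF measurable_model_map f])
  also have "\<dots> = (\<integral>\<^sup>+ x. \<integral>\<^sup>+ y. f (x, y) * ennreal (normal_density (?m x) \<sigma> y) \<partial>lborel \<partial>X)"
  proof (intro nn_integral_cong)
    fix x assume x: "x \<in> space X"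
    note [measurable] = fc[OF x]
    have "(\<integral>\<^sup>+ y. f (x, y) * ennreal (normal_density (?m x) \<sigma> y) \<partial>lborel) =
        (\<integral>\<^sup>+ e. f (x, ?m x + e) * ennreal (normal_density (?m x) \<sigma> (?m x + e)) \<partial>lborel)"
      by (subst nn_integral_real_affine[where c = 1 and t = "?m x"]) auto
    also have "\<dots> = (\<integral>\<^sup>+ e. ennreal (normal_density 0 \<sigma> e) * f (x, ?m x + e) \<partial>lborel)"
      by (intro nn_integral_cong) (simp add: normal_density_def mult.commute)
    also have "\<dots> = (\<integral>\<^sup>+ e. f (x, ?m x + e) \<partial>gauss \<sigma>)"
      unfolding gauss_def by (subst nn_integral_density) auto
    finally show "(\<integral>\<^sup>+ e. f (x, ?m x + e) \<partial>gauss \<sigma>) =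
        (\<integral>\<^sup>+ y. f (x, y) * ennreal (normal_density (?m x) \<sigma> y) \<partial>lborel)" ..
  qed
  finally show ?thesis .
qed

section \<open>Marginals and independence under the model law\<close>

lemma noise_model_map: "noise D \<beta> (x, (\<Sum>i<D. \<beta> i * x i) + e) = e"
  by (simp add: noise_def)

lemma measurable_noise [measurable]: "noise D \<beta> \<in> borel_measurable (obs_space D)"
  unfolding noise_def obs_space_def by measurable

text \<open>\<open>noise\<close> undoes the shift in the model map, so the preimage of the event is
  the box \<open>B \<times> E\<close>. Taking one side to be the whole space gives the marginals,
  and the product form then gives independence.\<close>

lemma emeasure_model_law_Int:
  assumes "B \<in> sets (\<Pi>\<^sub>M i\<in>{..<D}. borel)" and "E \<in> sets borel"
  shows "emeasure (model_law D X \<sigma> \<beta>)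
      ((fst -` B \<inter> space (obs_space D)) \<inter> (noise D \<beta> -` E \<inter> space (obs_space D))) =
    emeasure X B * emeasure (gauss \<sigma>) E" (is "emeasure _ ?S = _")
proof -
  have "fst -` B \<inter> space (obs_space D) \<in> sets (obs_space D)"
    using assms by (intro measurable_sets[of fst]) (auto simp: obs_space_def)
  moreover have "noise D \<beta> -` E \<inter> space (obs_space D) \<in> sets (obs_space D)"
    using assms by (intro measurable_sets[OF measurable_noise]) auto
  ultimately have "emeasure (model_law D X \<sigma> \<beta>) ?S = emeasure (X \<Otimes>\<^sub>M gauss \<sigma>)
      ((\<lambda>(x, e). (x, (\<Sum>i<D. \<beta> i * x i) + e)) -` ?S \<inter> space (X \<Otimes>\<^sub>M gauss \<sigma>))"
    unfolding model_law_def by (intro emeasure_distr measurable_model_map) (rule sets.Int)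
  also have "(\<lambda>(x, e). (x, (\<Sum>i<D. \<beta> i * x i) + e)) -` ?S \<inter> space (X \<Otimes>\<^sub>M gauss \<sigma>) = B \<times> E"
    using sets.sets_into_space[OF assms(1)] sets_eq_imp_space_eq[OF sets_X]
      sets_eq_imp_space_eq[OF sets_gauss[of \<sigma>]]
    by (auto simp: noise_model_map obs_space_def space_pair_measure)
  also have "emeasure (X \<Otimes>\<^sub>M gauss \<sigma>) (B \<times> E) = emeasure X B * emeasure (gauss \<sigma>) E"
    using assms by (intro N.emeasure_pair_measure_Times) auto
  finally show ?thesis .
qed

lemma emeasure_model_law_fst:
  assumes "B \<in> sets (\<Pi>\<^sub>M i\<in>{..<D}. borel)"
  shows "emeasure (model_law D X \<sigma> \<beta>) (fst -` B \<inter> space (obs_space D)) = emeasure X B"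
  using emeasure_model_law_Int[OF assms, of UNIV \<beta>] N.emeasure_space_1
    sets_eq_imp_space_eq[OF sets_gauss[of \<sigma>]] by (simp add: Int_absorb2)

lemma emeasure_model_law_noise:
  assumes "E \<in> sets borel"
  shows "emeasure (model_law D X \<sigma> \<beta>) (noise D \<beta> -` E \<inter> space (obs_space D)) =
    emeasure (gauss \<sigma>) E"
proof -
  have "fst -` space X \<inter> space (obs_space D) = space (obs_space D)"
    using sets_eq_imp_space_eq[OF sets_X] by (auto simp: obs_space_def space_pair_measure)
  with emeasure_model_law_Int[OF sets.top assms, of \<beta>] show ?thesis
    using X.emeasure_space_1 sets_eq_imp_space_eq[OF sets_X] by (simp add: Int_absorb1)
qed

lemma distr_model_law_fst:
  "distr (model_law D X \<sigma> \<beta>) (\<Pi>\<^sub>M i\<in>{..<D}. borel) fst = X"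
proof (rule measure_eqI)
  fix B assume "B \<in> sets (distr (model_law D X \<sigma> \<beta>) (\<Pi>\<^sub>M i\<in>{..<D}. borel) fst)"
  then show "emeasure (distr (model_law D X \<sigma> \<beta>) (\<Pi>\<^sub>M i\<in>{..<D}. borel) fst) B = emeasure X B"
    using emeasure_model_law_fst
    by (subst emeasure_distr) (auto simp: space_model_law obs_space_def cong: measurable_cong_sets)
qed simp

lemma measurable_fst_model_law [measurable]:
  "fst \<in> measurable (model_law D X \<sigma> \<beta>) (\<Pi>\<^sub>M i\<in>{..<D}. borel)"
  by (simp add: obs_space_def cong: measurable_cong_sets)

lemma integral_model_law_fst:
  fixes g :: "(nat \<Rightarrow> real) \<Rightarrow> real"
  assumes "g \<in> borel_measurable (\<Pi>\<^sub>M i\<in>{..<D}. borel)"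
  shows "(\<integral> z. g (fst z) \<partial>model_law D X \<sigma> \<beta>) = integral\<^sup>L X g"
  using integral_distr[OF measurable_fst_model_law assms, of \<beta>] by (simp add: distr_model_law_fst)

lemma integrable_model_law_fst:
  fixes g :: "(nat \<Rightarrow> real) \<Rightarrow> real"
  assumes "g \<in> borel_measurable (\<Pi>\<^sub>M i\<in>{..<D}. borel)"
  shows "integrable (model_law D X \<sigma> \<beta>) (\<lambda>z. g (fst z)) \<longleftrightarrow> integrable X g"
  using integrable_distr_eq[OF measurable_fst_model_law assms, of \<beta>]
  by (simp add: distr_model_law_fst)

text \<open>Moments of the covariates pass to the joint law because its first marginal is
  \<open>X\<close>; the law of the noise and the independence hold for every \<beta>. Hence a single
  \<open>X\<close> serves both points of the comparison.\<close>

lemma linear_model_model_law: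
  assumes sq: "\<And>i. i < D \<Longrightarrow> integrable X (\<lambda>x. (x i)\<^sup>2)"
    and cov: "mat D D (\<lambda>(i, j). covariance X (\<lambda>x. x i) (\<lambda>x. x j)) \<in> sym_mats D a A"
  shows "linear_model D a A \<sigma> \<beta> (model_law D X \<sigma> \<beta>)"
  unfolding linear_model_def
proof (intro conjI allI impI)
  interpret P: prob_space "model_law D X \<sigma> \<beta>" by (rule prob_space_model_law)
  let ?P = "model_law D X \<sigma> \<beta>"
  show "prob_space ?P" by (rule prob_space_model_law)
  show "sets ?P = sets (obs_space D)" by simp
  show "integrable ?P (\<lambda>z. (fst z i)\<^sup>2)" if "i < D" for i
    using sq[OF that] that
    by (subst integrable_model_law_fst[where g = "\<lambda>x. (x i)\<^sup>2"]) auto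
  have "cov_mat D ?P = mat D D (\<lambda>(i, j). covariance X (\<lambda>x. x i) (\<lambda>x. x j))"
    unfolding cov_mat_def
  proof (rule cong_mat, goal_cases)
    case (3 i j)
    then have mean: "(\<integral> z. fst z k \<partial>?P) = (\<integral> x. x k \<partial>X)" if "k < D" for k
      using that by (intro integral_model_law_fst) auto
    from 3 show ?case
      unfolding covariance_def prod.case
      by (simp add: mean) (rule integral_model_law_fst[where g = "\<lambda>x. (x i - _) * (x j - _)"], auto)
  qed auto
  with cov show "cov_mat D ?P \<in> sym_mats D a A" by simp
  have "distr ?P lborel (noise D \<beta>) = gauss \<sigma>"
  proof (rule measure_eqI)
    fix E assume "E \<in> sets (distr ?P lborel (noise D \<beta>))"
    then show "emeasure (distr ?P lborel (noise D \<beta>)) E = emeasure (gauss \<sigma>) E"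
      using emeasure_model_law_noise[of E \<beta>] measurable_noise[of \<beta>]
      by (subst emeasure_distr) (auto simp: space_model_law cong: measurable_cong_sets)
  qed simp
  then show "distributed ?P lborel (noise D \<beta>) (normal_density 0 \<sigma>)"
    unfolding distributed_def gauss_def
    using measurable_noise[of \<beta>] by (simp cong: measurable_cong_sets)
  show "P.indep_set {fst -` B \<inter> space ?P | B. B \<in> sets (\<Pi>\<^sub>M i\<in>{..<D}. borel)}
      {noise D \<beta> -` B \<inter> space ?P | B. B \<in> sets borel}"
  proof (rule P.indep_setI)
    show "{fst -` B \<inter> space ?P | B. B \<in> sets (\<Pi>\<^sub>M i\<in>{..<D}. borel)} \<subseteq> P.events"
      using measurable_sets[OF measurable_fst_model_law] by blast
    have "noise D \<beta> \<in> borel_measurable ?P"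
      using measurable_noise[of \<beta>] by (simp cong: measurable_cong_sets)
    then show "{noise D \<beta> -` B \<inter> space ?P | B. B \<in> sets borel} \<subseteq> P.events"
      using measurable_sets by blast
    show "P.prob (S \<inter> T) = P.prob S * P.prob T"
      if "S \<in> {fst -` B \<inter> space ?P | B. B \<in> sets (\<Pi>\<^sub>M i\<in>{..<D}. borel)}"
        and "T \<in> {noise D \<beta> -` B \<inter> space ?P | B. B \<in> sets borel}" for S T
    proof -
      from that obtain B E where BE: "B \<in> sets (\<Pi>\<^sub>M i\<in>{..<D}. borel)" "E \<in> sets borel"
        and ST: "S = fst -` B \<inter> space (obs_space D)" "T = noise D \<beta> -` E \<inter> space (obs_space D)"
        by (auto simp: space_model_law)
      show ?thesis
        unfolding measure_def ST
        by (simp only: emeasure_model_law_Int[OF BE] emeasure_model_law_fst[OF BE(1)]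
            emeasure_model_law_noise[OF BE(2)] enn2real_mult)
    qed
  qed
qed

section \<open>Likelihood ratio against zero coefficients\<close>

definition likelihood_ratio :: "(nat \<Rightarrow> real) \<Rightarrow> obs \<Rightarrow> real" where
  "likelihood_ratio \<beta> = (\<lambda>(x, y).
     exp ((2 * (\<Sum>i<D. \<beta> i * x i) * y - (\<Sum>i<D. \<beta> i * x i)\<^sup>2) / (2 * \<sigma>\<^sup>2)))"

lemma measurable_likelihood_ratio [measurable]:
  "likelihood_ratio \<beta> \<in> borel_measurable (obs_space D)"
  unfolding likelihood_ratio_def obs_space_def by measurable

lemma likelihood_ratio_nonneg: "0 \<le> likelihood_ratio \<beta> z"
  by (simp add: likelihood_ratio_def split: prod.split)

text \<open>The covariate law is common to both sides, so only the conditional normal densities of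
  \<open>y\<close>, with mean \<open>m = (\<Sum>i<D. \<beta> i * x i)\<close> and with mean 0,
  differ; \<open>likelihood_ratio\<close> is their quotient.\<close>

lemma model_law_eq_density:
  "model_law D X \<sigma> \<beta> = density (model_law D X \<sigma> (\<lambda>_. 0)) (likelihood_ratio \<beta>)"
proof (rule measure_eqI)
  fix S assume "S \<in> sets (model_law D X \<sigma> \<beta>)"
  then have [measurable]: "S \<in> sets (obs_space D)" by simp
  have *: "normal_density (\<Sum>i<D. \<beta> i * x i) \<sigma> y =
      likelihood_ratio \<beta> (x, y) * normal_density 0 \<sigma> y" for x y
    using \<sigma>
    by (simp add: normal_density_def likelihood_ratio_def flip: exp_add)
       (simp add: field_simps power2_eq_square)
  have "emeasure (density (model_law D X \<sigma> (\<lambda>_. 0)) (likelihood_ratio \<beta>)) S =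
      (\<integral>\<^sup>+ z. ennreal (likelihood_ratio \<beta> z) * indicator S z \<partial>model_law D X \<sigma> (\<lambda>_. 0))"
    by (rule emeasure_density) auto
  also have "\<dots> = (\<integral>\<^sup>+ x. \<integral>\<^sup>+ y. indicator S (x, y) *
      ennreal (normal_density (\<Sum>i<D. \<beta> i * x i) \<sigma> y) \<partial>lborel \<partial>X)"
    unfolding * by (subst nn_integral_model_law)
       (auto intro!: nn_integral_cong simp: ennreal_mult likelihood_ratio_nonneg split: split_indicator)
  also have "\<dots> = (\<integral>\<^sup>+ z. indicator S z \<partial>model_law D X \<sigma> \<beta>)"
    by (subst nn_integral_model_law) auto
  finally show "emeasure (model_law D X \<sigma> \<beta>) S =
      emeasure (density (model_law D X \<sigma> (\<lambda>_. 0)) (likelihood_ratio \<beta>)) S"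
    by simp
qed simp

text \<open>Completing the square turns the squared ratio times the centered density into
  \<open>exp (m^2 / \<sigma>^2)\<close> times the normal density with mean \<open>2 * m\<close>,
  where \<open>m\<close> is the linear form; that density integrates to 1 in
  \<open>y\<close>.\<close>

lemma nn_integral_likelihood_ratio_square:
  "(\<integral>\<^sup>+ z. ennreal ((likelihood_ratio \<beta> z)\<^sup>2) \<partial>model_law D X \<sigma> (\<lambda>_. 0)) =
    (\<integral>\<^sup>+ x. ennreal (exp ((\<Sum>i<D. \<beta> i * x i)\<^sup>2 / \<sigma>\<^sup>2)) \<partial>X)"
proof -
  let ?m = "\<lambda>x. \<Sum>i<D. \<beta> i * x i"
  have *: "(likelihood_ratio \<beta> (x, y))\<^sup>2 * normal_density 0 \<sigma> y =
      exp ((?m x)\<^sup>2 / \<sigma>\<^sup>2) * normal_density (2 * ?m x) \<sigma> y" for x y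
    using \<sigma>
    by (simp add: normal_density_def likelihood_ratio_def flip: exp_add exp_double)
       (simp add: field_simps power2_eq_square)
  have 1: "(\<integral>\<^sup>+ y. ennreal (normal_density \<mu> \<sigma> y) \<partial>lborel) = 1" for \<mu>
    using \<sigma> by (subst nn_integral_eq_integral) auto
  have "(\<integral>\<^sup>+ z. ennreal ((likelihood_ratio \<beta> z)\<^sup>2) \<partial>model_law D X \<sigma> (\<lambda>_. 0)) =
      (\<integral>\<^sup>+ x. \<integral>\<^sup>+ y. ennreal ((likelihood_ratio \<beta> (x, y))\<^sup>2 * normal_density 0 \<sigma> y) \<partial>lborel \<partial>X)"
    by (subst nn_integral_model_law) (auto simp: ennreal_mult)
  also have "\<dots> = (\<integral>\<^sup>+ x. \<integral>\<^sup>+ y. ennreal (exp ((?m x)\<^sup>2 / \<sigma>\<^sup>2)) *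
      ennreal (normal_density (2 * ?m x) \<sigma> y) \<partial>lborel \<partial>X)"
    unfolding * by (simp add: ennreal_mult)
  also have "\<dots> = (\<integral>\<^sup>+ x. ennreal (exp ((?m x)\<^sup>2 / \<sigma>\<^sup>2)) \<partial>X)"
    by (simp add: nn_integral_cmult 1)
  finally show ?thesis .
qed

end

section \<open>Two-point lower bound\<close>

text \<open>The supremum is at least \<open>y\<close> and the infimum at most \<open>x\<close>; the
  difference is taken in the extended reals because either may be infinite. If \<open>y < x\<close>,
  \<open>ennreal\<close> cuts the left side to 0.\<close>

lemma width_ge:
  assumes "x \<in> S" and "y \<in> S"
  shows "ennreal (y - x) \<le> width S"
proof -
  have "ereal (y - x) = ereal y - ereal x" by simp
  also have "\<dots> \<le> (SUP x\<in>S. ereal x) - (INF x\<in>S. ereal x)"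
    using assms by (intro ereal_minus_mono SUP_upper INF_lower)
  finally have "e2ennreal (ereal (y - x)) \<le> width S"
    unfolding width_def by (rule e2ennreal_mono)
  then show ?thesis by simp
qed

text \<open>The two-point argument for any pair of models linked by a density. \<open>K\<close> is
  the second moment of the ratio for one observation, \<open>t\<close> the weight of the chi-square
  bound. If the last factor is negative, \<open>ennreal\<close> makes the claim trivial.\<close>

lemma expected_sq_width_ge:
  assumes I: "I \<in> conf_intervals n D a A \<sigma> \<alpha>"
    and lin: "linear_model D a A \<sigma> \<beta>\<^sub>0 P\<^sub>0" "linear_model D a A \<sigma> \<beta>\<^sub>1 P\<^sub>1"
    and L [measurable]: "L \<in> borel_measurable P\<^sub>0" and L0: "\<And>z. 0 \<le> L z"
    and P\<^sub>1: "P\<^sub>1 = density P\<^sub>0 (\<lambda>z. ennreal (L z))"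
    and K: "(\<integral>\<^sup>+ z. ennreal ((L z)\<^sup>2) \<partial>P\<^sub>0) = ennreal K" "0 \<le> K"
    and t: "0 < t" and gap: "\<beta>\<^sub>0 0 \<le> \<beta>\<^sub>1 0"
  shows "ennreal ((\<beta>\<^sub>1 0 - \<beta>\<^sub>0 0)\<^sup>2 * (1 - 2 * \<alpha> - t / 2 - (K ^ n - 1) / (2 * t))) \<le>
    expected_sq_width n P\<^sub>0 I"
proof -
  let ?\<delta> = "\<beta>\<^sub>1 0 - \<beta>\<^sub>0 0"
  let ?Q = "iid_law n P\<^sub>0"
  have P: "prob_space P\<^sub>0" "prob_space P\<^sub>1"
    using lin by (auto simp: linear_model_def)
  interpret P\<^sub>0: prob_space P\<^sub>0 by fact
  interpret P\<^sub>1: prob_space P\<^sub>1 by fact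
  interpret product_sigma_finite "\<lambda>_::nat. P\<^sub>0" ..
  interpret Q: prob_space ?Q
    unfolding iid_law_def by (intro prob_space_PiM P)
  define R where "R w = (\<Prod>k<n. L (w k))" for w
  have R [measurable]: "R \<in> borel_measurable ?Q"
    unfolding R_def iid_law_def by measurable
  have R0: "0 \<le> R w" for w
    unfolding R_def by (intro prod_nonneg L0)
  have Q1: "iid_law n P\<^sub>1 = density ?Q (\<lambda>w. ennreal (R w))"
  proof -
    have "iid_law n P\<^sub>1 = density ?Q (\<lambda>w. \<Prod>k<n. ennreal (L (w k)))"
      unfolding iid_law_def P\<^sub>1 using P\<^sub>1.sigma_finite_measure_axioms
      by (intro PiM_density) (auto simp: P\<^sub>1 intro: P\<^sub>0.sigma_finite_measure_axioms)
    then show ?thesis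
      by (simp add: R_def prod_ennreal L0)
  qed
  have prob1: "prob_space (iid_law n P\<^sub>1)"
    unfolding iid_law_def by (intro prob_space_PiM P)
  \<comment> \<open>The observations are independent, so second moments multiply.\<close>
  have R2: "(\<integral>\<^sup>+ w. ennreal ((R w)\<^sup>2) \<partial>?Q) = ennreal (K ^ n)"
  proof -
    have "(\<integral>\<^sup>+ w. ennreal ((R w)\<^sup>2) \<partial>?Q) = (\<integral>\<^sup>+ w. (\<Prod>k<n. ennreal ((L (w k))\<^sup>2)) \<partial>?Q)"
      by (simp add: R_def prod_ennreal prod_power_distrib)
    also have "\<dots> = (\<Prod>k<n. \<integral>\<^sup>+ z. ennreal ((L z)\<^sup>2) \<partial>P\<^sub>0)"
      unfolding iid_law_def by (intro product_nn_integral_prod) auto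
    finally show ?thesis using K by (simp add: ennreal_power)
  qed
  define S where "S \<beta> = {w \<in> space ?Q. \<beta> 0 \<in> I w}" for \<beta> :: "nat \<Rightarrow> real"
  have sp: "sets (iid_law n P\<^sub>1) = sets ?Q" "space (iid_law n P\<^sub>1) = space ?Q"
    unfolding Q1 by simp_all
  have S0 [measurable]: "S \<beta>\<^sub>0 \<in> sets ?Q" and M0: "1 - \<alpha> \<le> measure ?Q (S \<beta>\<^sub>0)"
    using I lin(1) by (auto simp: conf_intervals_def S_def)
  have S1 [measurable]: "S \<beta>\<^sub>1 \<in> sets ?Q" and "1 - \<alpha> \<le> measure (iid_law n P\<^sub>1) (S \<beta>\<^sub>1)"
    using I lin(2) unfolding conf_intervals_def S_def sp(2)[symmetric] sp(1)[symmetric] by blast+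
  \<comment> \<open>Coverage of \<open>\<beta>\<^sub>1 0\<close> is guaranteed under
    \<open>P\<^sub>1\<close>; the change of measure carries it to \<open>?Q\<close>, where the two
    coverage events can be intersected.\<close>
  then have "1 - \<alpha> \<le> measure ?Q (S \<beta>\<^sub>1) + t / 2 + (K ^ n - 1) / (2 * t)"
    using measure_density_le_plus_chi_square[OF Q.prob_space_axioms _ R R0 R2 _ S1 t] prob1 \<open>0 \<le> K\<close>
    by (simp add: Q1)
  moreover have "measure ?Q (S \<beta>\<^sub>0) + measure ?Q (S \<beta>\<^sub>1) \<le> 1 + measure ?Q (S \<beta>\<^sub>0 \<inter> S \<beta>\<^sub>1)"
  proof -
    have "measure ?Q (S \<beta>\<^sub>0 \<union> S \<beta>\<^sub>1) =
        measure ?Q (S \<beta>\<^sub>0) + measure ?Q (S \<beta>\<^sub>1) - measure ?Q (S \<beta>\<^sub>0 \<inter> S \<beta>\<^sub>1)"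
      by (rule measure_Un3) (auto simp: Q.fmeasurable_eq_sets)
    then show ?thesis using Q.prob_le_1[of "S \<beta>\<^sub>0 \<union> S \<beta>\<^sub>1"] by linarith
  qed
  ultimately have "1 - 2 * \<alpha> - t / 2 - (K ^ n - 1) / (2 * t) \<le> measure ?Q (S \<beta>\<^sub>0 \<inter> S \<beta>\<^sub>1)"
    using M0 by linarith
  then have "ennreal (?\<delta>\<^sup>2 * (1 - 2 * \<alpha> - t / 2 - (K ^ n - 1) / (2 * t))) \<le>
      ennreal (?\<delta>\<^sup>2 * measure ?Q (S \<beta>\<^sub>0 \<inter> S \<beta>\<^sub>1))"
    by (intro ennreal_leI mult_left_mono) auto
  also have "\<dots> = (\<integral>\<^sup>+ w. ennreal (?\<delta>\<^sup>2) * indicator (S \<beta>\<^sub>0 \<inter> S \<beta>\<^sub>1) w \<partial>?Q)"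
    by (subst nn_integral_cmult_indicator) (auto simp: Q.emeasure_eq_measure ennreal_mult)
  \<comment> \<open>On the intersection \<open>I w\<close> contains both coefficients. Monotonicity
    also holds for the lower integral, which covers a width that is not measurable.\<close>
  also have "\<dots> \<le> (\<integral>\<^sup>+ w. (width (I w))\<^sup>2 \<partial>?Q)"
  proof (rule nn_integral_mono)
    fix w
    show "ennreal (?\<delta>\<^sup>2) * indicator (S \<beta>\<^sub>0 \<inter> S \<beta>\<^sub>1) w \<le> (width (I w))\<^sup>2"
    proof (cases "w \<in> S \<beta>\<^sub>0 \<inter> S \<beta>\<^sub>1")
      case True
      then have "ennreal ?\<delta> \<le> width (I w)"
        by (intro width_ge) (auto simp: S_def)
      then have "(ennreal ?\<delta>)\<^sup>2 \<le> (width (I w))\<^sup>2"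
        by (intro power_mono) auto
      with True gap show ?thesis by (simp add: ennreal_power)
    qed simp
  qed
  finally show ?thesis
    by (simp add: expected_sq_width_def)
qed

theorem theorem1:
  fixes a A \<sigma> \<alpha> :: real and D :: "nat \<Rightarrow> nat"
  assumes "0 < a" and "a \<le> A" and "0 < \<sigma>"
    and "0 < \<alpha>" and "\<alpha> < 1/3"
  shows "\<exists>C>0. \<forall>n. 1 \<le> D n \<and> real (D n) < real n - real (D n) - 1 \<longrightarrow>
    (INF I\<in>conf_intervals n (D n) a A \<sigma> \<alpha>. SUP P\<in>model_class (D n) a A \<sigma>. expected_sq_width n P I)
      \<ge> ennreal (C / (real n - real (D n) + 1))"
proof -
  \<comment> \<open>Chosen so that \<open>\<delta>^2 = c / n\<close> makes the exponent
    \<open>n * (\<delta>^2 * a / \<sigma>^2)\<close> equal to \<open>ln (37 / 36)\<close>;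
    \<open>c\<close> depends on neither \<open>n\<close> nor \<open>D\<close>.\<close>
  define c where "c = \<sigma>\<^sup>2 / a * ln (37 / 36)"
  have c: "0 < c" using assms by (simp add: c_def)
  have "ennreal (c / 12 / (real n - real (D n) + 1)) \<le>
      (INF I\<in>conf_intervals n (D n) a A \<sigma> \<alpha>. SUP P\<in>model_class (D n) a A \<sigma>. expected_sq_width n P I)"
    if D: "1 \<le> D n" "real (D n) < real n - real (D n) - 1" for n
  proof (rule INF_greatest)
    fix I assume I: "I \<in> conf_intervals n (D n) a A \<sigma> \<alpha>"
    have n: "0 < real n" using D by linarith
    define \<delta> where "\<delta> = sqrt (c / n)"
    have \<delta>: "0 < \<delta>" "\<delta>\<^sup>2 = c / n" using c n by (auto simp: \<delta>_def)
    define \<beta> where "\<beta> i = (if i = 0 then \<delta> else 0)" for i :: nat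
    \<comment> \<open>The scale \<open>sqrt a\<close> gives the covariance \<open>a I\<close>, whose
      only eigenvalue \<open>a\<close> lies between \<open>a\<close> and \<open>A\<close>.\<close>
    define X where "X = sign_covariates (D n) (sqrt a)"
    have X: "prob_space X" "sets X = sets (\<Pi>\<^sub>M i\<in>{..<D n}. borel)"
      by (simp_all add: X_def prob_space_sign_covariates)
    interpret X: prob_space X by fact
    have sa: "0 < sqrt a" using \<open>0 < a\<close> by simp
    note moments = sign_covariates_moments[OF sa, of _ "D n", folded X_def]
    have "mat (D n) (D n) (\<lambda>(i, j). covariance X (\<lambda>x. x i) (\<lambda>x. x j)) = a \<cdot>\<^sub>m 1\<^sub>m (D n)"
      using \<open>0 < a\<close> by (intro eq_matI) (auto simp: covariance_def moments)
    then have cov: "mat (D n) (D n) (\<lambda>(i, j). covariance X (\<lambda>x. x i) (\<lambda>x. x j)) \<in>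
        sym_mats (D n) a A"
      using D \<open>a \<le> A\<close> by (auto simp: sym_mats_def spectrum_smult_one intro!: eq_matI)
    have sq: "integrable X (\<lambda>x. (x i)\<^sup>2)" if "i < D n" for i
      using moments(1)[OF that that] by (simp add: power2_eq_square)
    define P where "P = model_law (D n) X \<sigma>"
    have lin: "linear_model (D n) a A \<sigma> b (P b)" for b
      unfolding P_def by (rule linear_model_model_law[OF X \<open>0 < \<sigma>\<close> sq cov])
    define L where "L = likelihood_ratio (D n) \<sigma> \<beta>"
    define K where "K = exp (\<delta>\<^sup>2 * a / \<sigma>\<^sup>2)"
    \<comment> \<open>Here \<open>1 \<le> D n\<close> puts the index 0 into the sum.\<close>
    have "(\<Sum>i<D n. \<beta> i * x i) = \<delta> * x 0" for x
      using D by (simp add: \<beta>_def if_distrib if_distribR cong: if_cong)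
    then have "(\<integral>\<^sup>+ z. ennreal ((L z)\<^sup>2) \<partial>P (\<lambda>_. 0)) =
        (\<integral>\<^sup>+ x. ennreal (exp ((\<delta> * x 0)\<^sup>2 / \<sigma>\<^sup>2)) \<partial>X)"
      unfolding L_def P_def by (simp add: nn_integral_likelihood_ratio_square[OF X \<open>0 < \<sigma>\<close>])
    also have "\<dots> = (\<integral>\<^sup>+ x. ennreal K \<partial>X)"
    proof (rule nn_integral_cong_AE)
      \<comment> \<open>Signs have constant square, so the exponent does not vary with
        \<open>x\<close> and the second moment is exactly \<open>K\<close>.\<close>
      have "AE x in X. (x 0)\<^sup>2 = a"
        using AE_sign_covariates[of 0 "D n" "sqrt a"] D \<open>0 < a\<close> unfolding X_def by simp
      then show "AE x in X. ennreal (exp ((\<delta> * x 0)\<^sup>2 / \<sigma>\<^sup>2)) = ennreal K"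
        by eventually_elim (simp add: K_def power_mult_distrib)
    qed
    also have "\<dots> = ennreal K"
      by (simp add: X.emeasure_space_1)
    finally have LK: "(\<integral>\<^sup>+ z. ennreal ((L z)\<^sup>2) \<partial>P (\<lambda>_. 0)) = ennreal K" .
    have Kn: "K ^ n = 37 / 36"
    proof -
      have "K ^ n = exp (real n * (\<delta>\<^sup>2 * a / \<sigma>\<^sup>2))"
        by (simp only: K_def exp_of_nat_mult)
      also have "real n * (\<delta>\<^sup>2 * a / \<sigma>\<^sup>2) = ln (37 / 36)"
        using n \<open>0 < a\<close> \<open>0 < \<sigma>\<close> by (simp add: \<delta> c_def field_simps)
      finally show ?thesis by simp
    qed
    \<comment> \<open>The weight \<open>1/6\<close> is the optimal \<open>sqrt (K ^ n - 1)\<close>;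
      both error terms then equal \<open>1/12\<close>.\<close>
    have "ennreal (\<delta>\<^sup>2 * (1 - 2 * \<alpha> - (1/6) / 2 - (K ^ n - 1) / (2 * (1/6)))) \<le>
        expected_sq_width n (P (\<lambda>_. 0)) I"
    proof -
      have "L \<in> borel_measurable (P (\<lambda>_. 0))"
        using measurable_likelihood_ratio[OF X \<open>0 < \<sigma>\<close>, of \<beta>]
        by (simp add: L_def P_def sets_model_law[OF X \<open>0 < \<sigma>\<close>] cong: measurable_cong_sets)
      moreover have "P \<beta> = density (P (\<lambda>_. 0)) (\<lambda>z. ennreal (L z))"
        unfolding P_def L_def by (rule model_law_eq_density[OF X \<open>0 < \<sigma>\<close>])
      ultimately show ?thesis
        using expected_sq_width_ge[OF I lin lin _ _ _ LK, of \<beta> "1/6"] \<delta>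
          likelihood_ratio_nonneg[OF X \<open>0 < \<sigma>\<close>, of \<beta>]
        by (simp add: \<beta>_def K_def L_def)
    qed
    moreover have "c / 12 / (real n - real (D n) + 1) \<le>
        \<delta>\<^sup>2 * (1 - 2 * \<alpha> - (1/6) / 2 - (K ^ n - 1) / (2 * (1/6)))"
    proof -
      \<comment> \<open>From \<open>2 D + 1 < n\<close> follows
        \<open>n - D + 1 \<ge> n / 2\<close>; the constant \<open>1/12\<close> is this half times
        the probability \<open>1/6\<close> that remains.\<close>
      have "c / 12 / (real n - real (D n) + 1) \<le> c / 12 / (real n / 2)"
        using D n c by (intro divide_left_mono) auto
      also have "\<dots> = c / n * (1 / 6)" by simp
      also have "\<dots> \<le> \<delta>\<^sup>2 * (1 - 2 * \<alpha> - (1/6) / 2 - (K ^ n - 1) / (2 * (1/6)))"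
        unfolding Kn \<delta>(2) using \<open>\<alpha> < 1/3\<close> c n by (intro mult_left_mono) auto
      finally show ?thesis .
    qed
    ultimately have "ennreal (c / 12 / (real n - real (D n) + 1)) \<le>
        expected_sq_width n (P (\<lambda>_. 0)) I"
      by (meson ennreal_leI order_trans)
    \<comment> \<open>The supremum is bounded below by its value at the model with zero
      coefficients; the alternative only forces a large width there.\<close>
    also have "\<dots> \<le> (SUP P\<in>model_class (D n) a A \<sigma>. expected_sq_width n P I)"
      using lin by (intro SUP_upper) (auto simp: model_class_def)
    finally show "ennreal (c / 12 / (real n - real (D n) + 1)) \<le>
        (SUP P\<in>model_class (D n) a A \<sigma>. expected_sq_width n P I)" .
  qed
  then show ?thesis
    using c by (intro exI[of _ "c / 12"]) auto
qed

end
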